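(* Let $T$ be a triangle in the Euclidean plane whose three side lengths all lie in $\sqrt3\,\mathbb N=\{k\sqrt3 : k\in\mathbb N\}$ and whose area lies in $\frac{\sqrt3}{4}\mathbb N=\{\frac{k\sqrt3}{4}: k\in\mathbb N\}$, and suppose that the perimeter of $T$ is strictly greater than its area. Then, up to the ordering of the sides, either $T$ is the equilateral triangle with side length $3\sqrt3$, or $T$ belongs to one of the following three families: (a) $T$ has side lengths $x\sqrt3,\ x\sqrt3,\ \sqrt3$, where $1=4x^2-3y^2$ for some $x,y\in\mathbb N$; (b) $T$ has side lengths $x\sqrt3,\ x\sqrt3,\ 2\sqrt3$, where $1=x^2-3y^2$ for some $x,y\in\mathbb N$; (c) $T$ has side lengths $(3x+1)\sqrt3,\ (3x-1)\sqrt3,\ 3\sqrt3$, where $1=4x^2-15y^2$ for some $x,y\in\mathbb N$.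
   Context: Here $\mathbb N=\{1,2,3,\dots\}$ denotes the positive integers. A triangle means a non-degenerate triangle (positive area). *)

theory Defs
  imports "HOL-Analysis.Analysis" "HOL-Library.Multiset"
begin

text \<open>The area of a triangle is the Lebesgue measure of the region it bounds.\<close>

definition triangle_area :: "real ^ 2 \<Rightarrow> real ^ 2 \<Rightarrow> real ^ 2 \<Rightarrow> real" where
  "triangle_area A B C = measure lebesgue (convex hull {A, B, C})"

definition is_triangle :: "real ^ 2 \<Rightarrow> real ^ 2 \<Rightarrow> real ^ 2 \<Rightarrow> bool" where
  "is_triangle A B C \<longleftrightarrow> 0 < triangle_area A B C"

definition perimeter :: "real ^ 2 \<Rightarrow> real ^ 2 \<Rightarrow> real ^ 2 \<Rightarrow> real" where
  "perimeter A B C = dist A B + dist B C + dist C A"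

text \<open>A multiset, so that comparing side lengths ignores their order but not repetitions.\<close>

definition side_lengths :: "real ^ 2 \<Rightarrow> real ^ 2 \<Rightarrow> real ^ 2 \<Rightarrow> real multiset" where
  "side_lengths A B C = {#dist A B, dist B C, dist C A#}"

definition pos_multiples :: "real \<Rightarrow> real set" where
  "pos_multiples r = {real k * r | k :: nat. k \<ge> 1}"

end

theory Submission
  imports Defs
begin

text \<open>Write the sides as \<open>a\<surd>3 \<ge> b\<surd>3 \<ge> c\<surd>3\<close> and put \<open>u = b + c - a\<close>, \<open>v = a + c - b\<close>,
  \<open>w = a + b - c\<close>, three positive integers of equal parity with \<open>u \<le> v \<le> w\<close>. Heron's formula turns
  the area condition into \<open>(u + v + w)uvw = 3m\<^sup>2\<close> with area \<open>3m\<surd>3/4\<close>, and squaring the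
  perimeter condition gives \<open>3uvw < 16(u + v + w) \<le> 48w\<close>, hence \<open>uv < 16\<close>. For
  \<open>(u, v) = (1, 1), (2, 2), (1, 5)\<close> the equation is one of the three Pell equations, for \<open>(1, 3)\<close> it
  asks for two positive squares at distance 4, and the remaining pairs bound \<open>w\<close>.\<close>

section \<open>Integer solutions of the Heron equation\<close>

text \<open>The substitution \<open>w = 2 * x - 2\<close> turns the left side into
  \<open>16 * (x\<^sup>2 - 1)\<close>; then 4 divides \<open>m\<close>, and \<open>m = 4 * y\<close>
  gives the Pell equation.\<close>

lemma pell_shifted_even:
  fixes w m :: int
  assumes "(2 + 2 + w) * 2 * 2 * w = 3 * m\<^sup>2" "even w" "2 \<le> w" "0 < m"
  shows "\<exists>x y. 1 \<le> x \<and> 1 \<le> y \<and> w = 2 * x - 2 \<and> 1 = x\<^sup>2 - 3 * y\<^sup>2"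
proof -
  from \<open>even w\<close> obtain z where z: "w = 2 * z" by blast
  define x where "x = z + 1"
  have w: "w = 2 * x - 2" by (simp add: x_def z)
  have 1: "16 * (x\<^sup>2 - 1) = 3 * m\<^sup>2"
    using assms(1) by (simp add: w algebra_simps power2_eq_square)
  have "even (3 * m\<^sup>2)" by (simp flip: 1)
  then have "even m" by simp
  then obtain n where n: "m = 2 * n" by blast
  have 2: "4 * (x\<^sup>2 - 1) = 3 * n\<^sup>2"
    using 1 by (simp add: n power_mult_distrib)
  have "even (3 * n\<^sup>2)" by (simp flip: 2)
  then have "even n" by simp
  then obtain y where y: "n = 2 * y" by blast
  have "1 = x\<^sup>2 - 3 * y\<^sup>2"
    using 2 by (simp add: y power_mult_distrib)
  then show ?thesis
    using w assms(3,4) n y by (intro exI[of _ x] exI[of _ y]) auto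
qed

text \<open>Reduction modulo 3 forces \<open>w = 3 * t\<close>, so
  \<open>15 * (t\<^sup>2 + 2 * t) = m\<^sup>2\<close> and 15 divides \<open>m\<close>. Completing
  the square, with \<open>t + 1 = 2 * x\<close> even, gives the equation.\<close>

lemma pell_fifteen_shifted:
  fixes w m :: int
  assumes eq: "(1 + 5 + w) * 1 * 5 * w = 3 * m\<^sup>2" and "odd w" "5 \<le> w" "0 < m"
  shows "\<exists>x y. 1 \<le> x \<and> 1 \<le> y \<and> w = 6 * x - 3 \<and> 1 = 4 * x\<^sup>2 - 15 * y\<^sup>2"
proof -
  have p3: "prime (3::int)" and p5: "prime (5::int)" by simp_all
  have "5 * w\<^sup>2 = 3 * (m\<^sup>2 - 10 * w)"
    using eq by (simp add: algebra_simps power2_eq_square)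
  then have "3 dvd 5 * w\<^sup>2" by simp
  then have "3 dvd w"
    using p3 by (auto simp: prime_dvd_mult_iff prime_dvd_power_iff)
  then obtain t where t: "w = 3 * t" by blast
  then have "odd t" using \<open>odd w\<close> by simp
  then obtain z where z: "t = 2 * z + 1" by (rule oddE)
  define x where "x = z + 1"
  have tx: "t = 2 * x - 1" by (simp add: x_def z)
  have 1: "15 * (t\<^sup>2 + 2 * t) = m\<^sup>2"
    using eq by (simp add: t algebra_simps power2_eq_square)
  have "3 dvd m\<^sup>2" "5 dvd m\<^sup>2" unfolding 1[symmetric] by presburger+
  then have "3 dvd m" "5 dvd m"
    using p3 p5 prime_dvd_power by blast+
  then have "15 dvd m" by presburger
  then obtain y where y: "m = 15 * y" by blast
  have "t\<^sup>2 + 2 * t = 15 * y\<^sup>2"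
    using 1 by (simp add: y power_mult_distrib)
  then have "1 = 4 * x\<^sup>2 - 15 * y\<^sup>2"
    by (simp add: tx algebra_simps power2_eq_square)
  then show ?thesis
    using t tx y \<open>0 < m\<close> \<open>5 \<le> w\<close> by (intro exI[of _ x] exI[of _ y]) auto
qed

text \<open>The left side is \<open>(w + 2)\<^sup>2 - 4\<close>, strictly between
  \<open>w\<^sup>2\<close> and \<open>(w + 2)\<^sup>2\<close>. That leaves \<open>m = w + 1\<close>,
  which fails by parity.\<close>

lemma no_squares_at_distance_four:
  fixes w m :: int
  assumes "(4 + w) * w = m\<^sup>2" "0 < w" "0 < m"
  shows False
proof -
  have "w\<^sup>2 < m\<^sup>2" "m\<^sup>2 < (w + 2)\<^sup>2"
    using assms by (simp_all add: algebra_simps power2_eq_square flip: assms(1))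
  then have "w < m" "m < w + 2"
    using assms by (auto intro: power2_less_imp_less)
  then have "m = w + 1" by simp
  then show False
    using assms(1) by (simp add: algebra_simps power2_eq_square) presburger
qed

text \<open>The equation does have the solution \<open>(u, v, w) = (1, 13, 13)\<close>, \<open>m = 39\<close>, which the
  perimeter condition excludes; the ranges below contain all triples that it leaves.\<close>

lemma heron_equation_small_cases:
  "\<forall>v\<in>set [7, 9, 11::int]. \<forall>w\<in>set [v..25]. \<forall>m\<in>set [1..51::int].
     (1 + v + w) * 1 * v * w \<noteq> 3 * m\<^sup>2"
  "\<forall>v\<in>set [4, 6::int]. \<forall>w\<in>set [v..11]. \<forall>m\<in>set [1..51::int].
     (2 + v + w) * 2 * v * w \<noteq> 3 * m\<^sup>2"
  "\<forall>w\<in>set [4..8]. \<forall>m\<in>set [1..51::int]. (3 + 3 + w) * 3 * 3 * w \<noteq> 3 * m\<^sup>2"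
  by code_simp+

lemma heron_diophantine:
  fixes u v w m :: int
  assumes "0 < u" "u \<le> v" "v \<le> w" and par: "even (u + v)" "even (v + w)"
    and "0 < m" and eq: "(u + v + w) * u * v * w = 3 * m\<^sup>2"
    and less: "3 * m < 4 * (u + v + w)"
  shows "u = 3 \<and> v = 3 \<and> w = 3
    \<or> u = 1 \<and> v = 1 \<and> (\<exists>x y. 1 \<le> x \<and> 1 \<le> y \<and> w = 2 * x - 1 \<and> 1 = 4 * x\<^sup>2 - 3 * y\<^sup>2)
    \<or> u = 2 \<and> v = 2 \<and> (\<exists>x y. 1 \<le> x \<and> 1 \<le> y \<and> w = 2 * x - 2 \<and> 1 = x\<^sup>2 - 3 * y\<^sup>2)
    \<or> u = 1 \<and> v = 5 \<and> (\<exists>x y. 1 \<le> x \<and> 1 \<le> y \<and> w = 6 * x - 3 \<and> 1 = 4 * x\<^sup>2 - 15 * y\<^sup>2)"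
proof -
  let ?p = "u + v + w"
  have "(3 * m)\<^sup>2 < (4 * ?p)\<^sup>2"
    using less \<open>0 < m\<close> by (intro power_strict_mono) auto
  then have "3 * (3 * m\<^sup>2) < 16 * ?p * ?p"
    by (simp add: power_mult_distrib power2_eq_square algebra_simps)
  \<comment> \<open>Substituting for \<open>3 * m\<^sup>2\<close> leaves a positive common factor
    \<open>?p\<close> to cancel.\<close>
  then have "?p * (3 * (u * v * w)) < ?p * (16 * ?p)"
    unfolding eq[symmetric] by (simp add: mult_ac)
  then have bound: "3 * (u * v * w) < 16 * ?p"
    using assms(1-3) by (simp only: mult_less_cancel_left_pos)
  also have "\<dots> \<le> 48 * w" using assms(2,3) by simp
  finally have "w * (u * v) < w * 16" by (simp add: mult_ac)
  then have uv: "u * v < 16"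
    using assms(1-3) by (simp only: mult_less_cancel_left_pos)
  have "u * u \<le> u * v" using assms(1,2) by simp
  then have "u * u < 4 * 4" using uv by simp
  then have "u < 4"
    using mult_mono[of 4 u 4 u] by linarith
  then consider "u = 1" | "u = 2" | "u = 3" using \<open>0 < u\<close> by linarith
  then show ?thesis
  proof cases
    case 1
    have "v < 16" using uv 1 by simp
    then have "v = 1 \<or> v = 3 \<or> v = 5 \<or> v \<in> {7, 9, 11} \<or> 13 \<le> v"
      using par(1) assms(2) unfolding 1 insert_iff empty_iff by presburger
    then consider "v = 1" | "v = 3" | "v = 5" | "v \<in> {7, 9, 11}" | "13 \<le> v" by blast
    then show ?thesis
    proof cases
      case v: 1
      have "odd w" using par(2) v by simp
      then obtain z where z: "w = 2 * z + 1" by (rule oddE)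
      \<comment> \<open>Here \<open>(2 + w) * w = (w + 1)\<^sup>2 - 1\<close> and
        \<open>w + 1 = 2 * (z + 1)\<close>, so \<open>m\<close> itself serves as
        \<open>y\<close>.\<close>
      have "1 = 4 * (z + 1)\<^sup>2 - 3 * m\<^sup>2"
        using eq unfolding 1 v z by (simp add: algebra_simps power2_eq_square)
      then have "\<exists>x y. 1 \<le> x \<and> 1 \<le> y \<and> w = 2 * x - 1 \<and> 1 = 4 * x\<^sup>2 - 3 * y\<^sup>2"
        using z assms(3) \<open>0 < m\<close> v by (intro exI[of _ "z + 1"] exI[of _ m]) auto
      then show ?thesis using 1 v by blast
    next
      case v: 2
      have "(4 + w) * w = m\<^sup>2" using eq unfolding 1 v by (simp add: algebra_simps)
      then show ?thesis
        using no_squares_at_distance_four assms(3,6) v by fastforce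
    next
      case v: 3
      have "odd w" using par(2) v by simp
      then show ?thesis
        using pell_fifteen_shifted[of w m] eq assms(3,6) unfolding 1 v by simp
    next
      case v: 4
      \<comment> \<open>\<open>bound\<close> reads \<open>(3 * v - 16) * w < 16 * (1 + v)\<close>,
        which is weakest at \<open>v = 7\<close> and gives \<open>w \<le> 25\<close> there; the cap
        51 on \<open>m\<close> is generous.\<close>
      have "v \<in> set [7, 9, 11]" "w \<in> set [v..25]" "m \<in> set [1..51]"
        using v less 1 assms(3,6) bound by auto
      then show ?thesis using heron_equation_small_cases(1) eq unfolding 1 by blast
    next
      case v: 5
      \<comment> \<open>With \<open>v \<le> w\<close>, \<open>bound\<close> would give
        \<open>39 * w < 16 * (1 + 2 * w)\<close>, hence \<open>w \<le> 2\<close>.\<close>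
      then have "13 * w \<le> v * w" using assms(3) by (intro mult_right_mono) auto
      then have "39 * w < 16 * (1 + v + w)" using bound 1 by simp
      then have False using v assms(3) by simp
      then show ?thesis ..
    qed
  next
    case 2
    have "v < 8" using uv 2 by simp
    then have "v = 2 \<or> v \<in> {4, 6}"
      using par(1) assms(2) unfolding 2 insert_iff empty_iff by presburger
    then show ?thesis
    proof
      assume v: "v = 2"
      have "even w" using par(2) v by simp
      then show ?thesis
        using pell_shifted_even[of w m] eq assms(3,6) unfolding 2 v by simp
    next
      assume v: "v \<in> {4, 6}"
      \<comment> \<open>For \<open>v = 4\<close>, \<open>bound\<close> amounts to
        \<open>8 * w < 96\<close>; \<open>v = 6\<close> is more restrictive.\<close>
      then have "v \<in> set [4, 6]" "w \<in> set [v..11]" "m \<in> set [1..51]"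
        using less 2 assms(3,6) bound by auto
      then show ?thesis using heron_equation_small_cases(2) eq unfolding 2 by blast
    qed
  next
    case 3
    \<comment> \<open>\<open>uv\<close> leaves \<open>v \<le> 5\<close>; parity removes 4, and for 5
      \<open>bound\<close> would force \<open>w \<le> 4\<close>.\<close>
    then have "v = 3" using uv bound assms(2,3) par(1) by (cases "v = 4"; cases "v = 5") auto
    show ?thesis
    proof (cases "w = 3")
      case False
      then have "w \<in> set [4..8]" "m \<in> set [1..51]"
        using \<open>v = 3\<close> less 3 assms(3,6) bound by auto
      then show ?thesis using heron_equation_small_cases(3) eq unfolding 3 \<open>v = 3\<close> by blast
    qed (use 3 \<open>v = 3\<close> in simp)
  qed
qed

section \<open>From triangles to the Heron equation\<close>

lemma triangle_area_heron:
  fixes A B C :: "real ^ 2"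
  shows "16 * (triangle_area A B C)\<^sup>2 =
    perimeter A B C * (dist B C + dist C A - dist A B) * (dist A B + dist C A - dist B C)
      * (dist A B + dist B C - dist C A)"
proof -
  let ?a = "dist B C" and ?b = "dist A C" and ?c = "dist A B"
  let ?s = "(?a + ?b + ?c) / 2"
  \<comment> \<open>Being compact, the hull is Borel, so its Lebesgue measure is its
    \<open>lborel\<close> measure.\<close>
  have "convex hull {A, B, C} \<in> sets lborel"
    by (simp add: borel_compact finite_imp_compact_convex_hull)
  then have "triangle_area A B C = sqrt (?s * (?s - ?a) * (?s - ?b) * (?s - ?c))"
    unfolding triangle_area_def by (subst measure_completion) (auto simp: heron)
  \<comment> \<open>The triangle inequalities make the radicand nonnegative, so squaring removes the
    root.\<close>
  moreover have "0 \<le> ?s * (?s - ?a) * (?s - ?b) * (?s - ?c)"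
    using dist_triangle[of A B C] dist_triangle[of A C B] dist_triangle[of B C A]
    by (intro mult_nonneg_nonneg) (auto simp: dist_commute)
  ultimately have "(triangle_area A B C)\<^sup>2 = ?s * (?s - ?a) * (?s - ?b) * (?s - ?c)"
    by simp
  then show ?thesis
    unfolding perimeter_def dist_commute[of C A] by (simp add: field_simps)
qed

text \<open>Allows the sides to be sorted; the multiset equation carries every symmetric expression
  over to the new names.\<close>

lemma sorted_triple:
  fixes a b c :: "'a :: linorder"
  obtains a' b' c' where "{#a, b, c#} = {#a', b', c'#}" "c' \<le> b'" "b' \<le> a'"
proof -
  let ?M = "{#a, b, c#}"
  have "length (sorted_list_of_multiset ?M) = Suc (Suc (Suc 0))"
    by (metis mset_sorted_list_of_multiset size_mset size_add_mset size_empty)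
  then obtain x y z where l: "sorted_list_of_multiset ?M = [x, y, z]"
    unfolding length_Suc_conv length_0_conv by blast
  have "?M = {#z, y, x#}"
    using mset_sorted_list_of_multiset[of ?M] unfolding l by (simp add: add_mset_commute)
  moreover have "sorted [x, y, z]"
    using sorted_sorted_list_of_multiset[of ?M] unfolding l .
  ultimately show ?thesis using that by simp
qed

text \<open>The order of the sides becomes \<open>u \<le> v \<le> w\<close>, and
  \<open>u + v = 2 * c\<close>, \<open>v + w = 2 * a\<close> supply the parity conditions.\<close>

lemma classify_sorted_sides:
  fixes a b c m :: nat
  assumes "c \<le> b" "b \<le> a" "a < b + c" "0 < m"
    and eq: "(int a + int b + int c) * (int b + int c - int a) * (int a + int c - int b)
      * (int a + int b - int c) = 3 * (int m)\<^sup>2"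
    and less: "3 * m < 4 * (a + b + c)"
  shows "a = 3 \<and> b = 3 \<and> c = 3
    \<or> (\<exists>x y :: nat. x \<ge> 1 \<and> y \<ge> 1 \<and> 1 = 4 * (int x)\<^sup>2 - 3 * (int y)\<^sup>2 \<and> a = x \<and> b = x \<and> c = 1)
    \<or> (\<exists>x y :: nat. x \<ge> 1 \<and> y \<ge> 1 \<and> 1 = (int x)\<^sup>2 - 3 * (int y)\<^sup>2 \<and> a = x \<and> b = x \<and> c = 2)
    \<or> (\<exists>x y :: nat. x \<ge> 1 \<and> y \<ge> 1 \<and> 1 = 4 * (int x)\<^sup>2 - 15 * (int y)\<^sup>2 \<and>
        a = 3 * x + 1 \<and> b = 3 * x - 1 \<and> c = 3)"
proof -
  define u v w where uvw: "u = int b + int c - int a" "v = int a + int c - int b"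
    "w = int a + int b - int c"
  have p: "u + v + w = int a + int b + int c" by (simp add: uvw)
  have "u + v = 2 * int c" "v + w = 2 * int a" by (simp_all add: uvw)
  then have par: "even (u + v)" "even (v + w)" by simp_all
  have *: "0 < u" "u \<le> v" "v \<le> w" "0 < int m"
    "(u + v + w) * u * v * w = 3 * (int m)\<^sup>2" "3 * int m < 4 * (u + v + w)"
    using assms by (simp_all add: p) (simp_all add: uvw)
  have sides: "2 * int a = v + w" "2 * int b = u + w" "2 * int c = u + v"
    by (simp_all add: uvw)
  from heron_diophantine[OF *(1-3) par *(4-)] show ?thesis
  proof (elim disjE conjE exE)
    assume "u = 3" "v = 3" "w = 3"
    then show ?thesis using sides by simp
  next
    fix x y :: int
    assume *: "u = 1" "v = 1" "1 \<le> x" "1 \<le> y" "w = 2 * x - 1" "1 = 4 * x\<^sup>2 - 3 * y\<^sup>2"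
    then obtain i j :: nat where "x = int i" "y = int j"
      by (metis zero_le_imp_eq_int zero_le_one order_trans)
    with * sides have "1 \<le> i" "1 \<le> j" "1 = 4 * (int i)\<^sup>2 - 3 * (int j)\<^sup>2" "a = i" "b = i" "c = 1"
      by simp_all
    then show ?thesis by blast
  next
    fix x y :: int
    assume *: "u = 2" "v = 2" "1 \<le> x" "1 \<le> y" "w = 2 * x - 2" "1 = x\<^sup>2 - 3 * y\<^sup>2"
    then obtain i j :: nat where "x = int i" "y = int j"
      by (metis zero_le_imp_eq_int zero_le_one order_trans)
    with * sides have "1 \<le> i" "1 \<le> j" "1 = (int i)\<^sup>2 - 3 * (int j)\<^sup>2" "a = i" "b = i" "c = 2"
      by simp_all
    then show ?thesis by blast
  next
    fix x y :: int
    assume *: "u = 1" "v = 5" "1 \<le> x" "1 \<le> y" "w = 6 * x - 3" "1 = 4 * x\<^sup>2 - 15 * y\<^sup>2"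
    then obtain i j :: nat where "x = int i" "y = int j"
      by (metis zero_le_imp_eq_int zero_le_one order_trans)
    with * sides have "1 \<le> i" "1 \<le> j" "1 = 4 * (int i)\<^sup>2 - 15 * (int j)\<^sup>2"
      "a = 3 * i + 1" "b = 3 * i - 1" "c = 3"
      by simp_all
    then show ?thesis by blast
  qed
qed

theorem theorem1:
  fixes A B C :: "real ^ 2"
  assumes "is_triangle A B C"
    and "set_mset (side_lengths A B C) \<subseteq> pos_multiples (sqrt 3)"
    and "triangle_area A B C \<in> pos_multiples (sqrt 3 / 4)"
    and "perimeter A B C > triangle_area A B C"
  shows "side_lengths A B C = {#3 * sqrt 3, 3 * sqrt 3, 3 * sqrt 3#}
    \<or> (\<exists>x y :: nat. x \<ge> 1 \<and> y \<ge> 1 \<and> 1 = 4 * (int x)\<^sup>2 - 3 * (int y)\<^sup>2 \<and>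
          side_lengths A B C = {#real x * sqrt 3, real x * sqrt 3, sqrt 3#})
    \<or> (\<exists>x y :: nat. x \<ge> 1 \<and> y \<ge> 1 \<and> 1 = (int x)\<^sup>2 - 3 * (int y)\<^sup>2 \<and>
          side_lengths A B C = {#real x * sqrt 3, real x * sqrt 3, 2 * sqrt 3#})
    \<or> (\<exists>x y :: nat. x \<ge> 1 \<and> y \<ge> 1 \<and> 1 = 4 * (int x)\<^sup>2 - 15 * (int y)\<^sup>2 \<and>
          side_lengths A B C = {#(3 * real x + 1) * sqrt 3, (3 * real x - 1) * sqrt 3, 3 * sqrt 3#})"
proof -
  obtain p where p: "p \<ge> 1" "dist A B = real p * sqrt 3"
    using assms(2) by (auto simp: side_lengths_def pos_multiples_def)
  obtain q where q: "q \<ge> 1" "dist B C = real q * sqrt 3"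
    using assms(2) by (auto simp: side_lengths_def pos_multiples_def)
  obtain r where r: "r \<ge> 1" "dist C A = real r * sqrt 3"
    using assms(2) by (auto simp: side_lengths_def pos_multiples_def)
  obtain k where k: "k \<ge> 1" "triangle_area A B C = real k * (sqrt 3 / 4)"
    using assms(3) by (auto simp: pos_multiples_def)
  let ?H = "\<lambda>x y z. (x + y + z) * (y + z - x) * (x + z - y) * (x + y - z)"
  obtain a b c where abc: "{#p, q, r#} = {#a, b, c#}" "c \<le> b" "b \<le> a"
    by (rule sorted_triple)
  have sides: "side_lengths A B C = {#real a * sqrt 3, real b * sqrt 3, real c * sqrt 3#}"
    using arg_cong[OF abc(1), of "image_mset (\<lambda>n. real n * sqrt 3)"]
    by (simp add: side_lengths_def p q r)
  have sum: "p + q + r = a + b + c"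
    using arg_cong[OF abc(1), of sum_mset] by simp
  \<comment> \<open>Each Heron factor is the perimeter minus twice one side, so their product
    depends only on the multiset.\<close>
  let ?P = "\<lambda>n. real (a + b + c) - 2 * real n"
  have prod: "?P p * ?P q * ?P r = ?P a * ?P b * ?P c"
    using arg_cong[OF abc(1), of "\<lambda>M. prod_mset (image_mset ?P M)"] by (simp add: mult_ac)
  have "16 * (real k * (sqrt 3 / 4))\<^sup>2
      = sqrt 3 ^ 4 * (real (p + q + r) * (?P p * ?P q * ?P r))"
  proof -
    \<comment> \<open>Heron's product is homogeneous of degree 4; \<open>t\<close> will be
      \<open>sqrt 3\<close>.\<close>
    have factor: "(x * t + y * t + z * t) * (y * t + z * t - x * t) * (x * t + z * t - y * t)
        * (x * t + y * t - z * t)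
      = t ^ 4 * ((x + y + z) * ((x + y + z - 2 * x) * (x + y + z - 2 * y) * (x + y + z - 2 * z)))"
      for x y z t :: real by algebra
    show ?thesis
      using triangle_area_heron[of A B C]
      unfolding sum[symmetric] perimeter_def k p q r of_nat_add factor .
  qed
  then have "16 * (real k * (sqrt 3 / 4))\<^sup>2
      = sqrt 3 ^ 4 * (real (a + b + c) * (?P a * ?P b * ?P c))"
    unfolding prod sum .
  moreover have "sqrt 3 ^ 4 = (9::real)"
    by (simp add: power4_eq_xxxx)
  ultimately have "(real k)\<^sup>2 = 3 * ?H (real a) (real b) (real c)"
    by (simp add: power_mult_distrib power_divide algebra_simps)
  also have "\<dots> = real_of_int (3 * ?H (int a) (int b) (int c))" by simp
  finally have kk: "(int k)\<^sup>2 = 3 * ?H (int a) (int b) (int c)"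
    by (metis of_int_eq_iff of_int_of_nat_eq of_int_power)
  then have "3 dvd (int k)\<^sup>2" by (metis dvd_triv_left)
  then have "3 dvd int k"
    using prime_dvd_power[of "3::int" "int k" 2] by simp
  then obtain m where m: "k = 3 * m" by (auto elim: dvdE simp: int_dvd_int_iff[of 3, simplified])
  have H: "?H (int a) (int b) (int c) = 3 * (int m)\<^sup>2"
    using kk by (simp add: m power_mult_distrib)
  have less: "3 * m < 4 * (a + b + c)"
  proof -
    have "real k * (sqrt 3 / 4) < real (a + b + c) * sqrt 3"
      using assms(4) unfolding sum[symmetric] perimeter_def k p q r by (simp add: algebra_simps)
    then have "sqrt 3 * real k < sqrt 3 * (4 * real (a + b + c))"
      by (simp add: algebra_simps)
    then have "real k < real (4 * (a + b + c))" by simp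
    then show ?thesis unfolding m of_nat_less_iff .
  qed
  \<comment> \<open>Otherwise exactly one kind of factor, \<open>b + c - a\<close>, is nonpositive,
    against the positive value of the product in \<open>H\<close>.\<close>
  have "a < b + c"
  proof (rule ccontr)
    assume "\<not> a < b + c"
    then have "?H (int a) (int b) (int c) \<le> 0"
      using abc(2,3) by (intro mult_nonpos_nonneg mult_nonneg_nonpos) auto
    then show False using H k(1) m by simp
  qed
  moreover have "0 < m" using k(1) m by simp
  \<comment> \<open>\<open>of_nat_diff\<close> applies to \<open>3 * x - 1\<close> because
    \<open>x \<ge> 1\<close>, so the subtraction on \<open>nat\<close> is not truncated.\<close>
  ultimately show ?thesis
    using classify_sorted_sides[OF abc(2,3) _ _ H less]
    unfolding sides by (force simp: of_nat_diff)
qed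

end
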